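(* Let $v\in V$, $v\ne0$, be such that its Rayleigh quotient satisfies $\lambda_1\le\lambda(v)<\lambda_2$. Let $\phi_A(v,\mathcal E_1)$ be the angle, with respect to the scalar product $\langle A\cdot,\cdot\rangle$ on $V$, between $v$ and the eigenspace $\mathcal E_1$. Then $$\sin\phi_A(v,\mathcal E_1)\le\sqrt{\frac{\lambda_2}{\lambda_1}\cdot\frac{\lambda(v)-\lambda_1}{\lambda_2-\lambda(v)}} .$$ Moreover, the eigenvector residual controls the angle, i.e. $$\frac{\lambda_1}{3\lambda(v)}\,\rho(v)\le\sin\phi_A(v,\mathcal E_1)\le\frac{\lambda_2}{\lambda_2-\lambda(v)}\,\rho(v).$$
   Context: Setting. $(H,(\cdot,\cdot),|\cdot|)$ is a separable real Hilbert space and $(V,\|\cdot\|)$ a reflexive separable real Banach space, $V\subset H$ dense and continuously embedded. $V\subset H\cong H^*\subset V^*$ is the Gelfand triple, with dual pairing $\langle\cdot,\cdot\rangle:V^*\times V\to\mathbb R$. $A:V\to V^*$ is linear, bounded, symmetric ($\langle Av,u\rangle=\langle Au,v\rangle$) and strongly positive ($\langle Av,v\rangle\ge\sigma_0\|v\|^2$ with $\sigma_0>0$). $E:H\to H^*$, $v\mapsto(\cdot,v)$, and its restriction $V\to V^*$ is also denoted $E$. Norms: $\|v\|_A=\langle Av,v\rangle^{1/2}$ for $v\in V$; $\|f\|_{A^{-1}}=\langle f,A^{-1}f\rangle^{1/2}$ for $f\in V^*$. Spectrum: $\lambda\in\mathbb R$ is an eigenvalue if $Av=\lambda Ev$ for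 some $v\in V\setminus\{0\}$ (an eigenvector). The resolvent set consists of those $\lambda\in\mathbb R$ for which $Av-\lambda Ev=f$ is uniquely solvable for all $f\in H^*$ with inverse mapping in $\mathcal L(H^*,V)$; the spectrum is its complement in $\mathbb R$. It is assumed that the lower part of the spectrum consists of eigenvalues $0<\lambda_1<\dots<\lambda_N$ ($N\ge2$) with finite-dimensional eigenspaces $\mathcal E_1,\dots,\mathcal E_N$, and that the rest of the spectrum is bounded from below by some $\Lambda>\lambda_N$ and is unbounded from above. Rayleigh quotient: $\lambda(v)=\langle Av,v\rangle/\langle Ev,v\rangle=\langle Av,v\rangle/(v,v)$ for $v\in V\setminus\{0\}$. Residual: $\rho(v)=\|Av-\lambda(v)Ev\|_{A^{-1}}/\|v\|_A$. If $v=v_\parallel+v_\perp$ is the orthogonal decomposition with respect to $\langle A\cdot,\cdot\rangle$ with $v_\parallel\in\mathcal E_1$ and $v_\perp\perp\mathcal E_1$, then $\sin\phi_A(v,\mathcal E_1)=\|v_\perp\|_A/\|v\|_A$. *)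

theory Defs
  imports "HOL-Analysis.Analysis"
begin

text \<open>
  The inclusion of \<open>V\<close> into \<open>H\<close> is an injective bounded linear map \<open>j\<close> between two types, so that
  each space keeps its own norm. Then \<open>V\<^sup>*\<close> is the type \<open>'v \<Rightarrow>\<^sub>L real\<close>, the pairing
  \<open>\<langle>f, v\<rangle>\<close> is application \<open>f v\<close>, and the inclusion of \<open>H\<^sup>*\<close> into \<open>V\<^sup>*\<close> is the
  restriction \<open>f \<mapsto> f o\<^sub>L j\<close>.
\<close>

definition reflexive_space :: "'a::real_normed_vector itself \<Rightarrow> bool" where
  "reflexive_space _ \<longleftrightarrow>
     (\<forall>F :: ('a \<Rightarrow>\<^sub>L real) \<Rightarrow>\<^sub>L real. \<exists>x :: 'a. \<forall>f. blinfun_apply F f = blinfun_apply f x)"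

definition gelfand_triple :: "('v::banach \<Rightarrow>\<^sub>L 'h::{real_inner,complete_space}) \<Rightarrow> bool" where
  "gelfand_triple j \<longleftrightarrow>
     separable_space (euclidean :: 'h topology) \<and>
     separable_space (euclidean :: 'v topology) \<and>
     reflexive_space TYPE('v) \<and>
     inj (blinfun_apply j) \<and>
     closure (range (blinfun_apply j)) = UNIV"

definition symmetric_op :: "('v::real_normed_vector \<Rightarrow>\<^sub>L ('v \<Rightarrow>\<^sub>L real)) \<Rightarrow> bool" where
  "symmetric_op A \<longleftrightarrow> (\<forall>u v. A v u = A u v)"

definition strongly_positive :: "('v::real_normed_vector \<Rightarrow>\<^sub>L ('v \<Rightarrow>\<^sub>L real)) \<Rightarrow> bool" where
  "strongly_positive A \<longleftrightarrow> (\<exists>\<sigma>\<^sub>0>0. \<forall>v. A v v \<ge> \<sigma>\<^sub>0 * (norm v)\<^sup>2)"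

text \<open>The map \<open>E\<close> in its restricted form \<open>V \<rightarrow> V\<^sup>*\<close>; on \<open>H\<close> it is \<^term>\<open>blinfun_inner_left\<close>.\<close>

definition opE :: "('v::real_normed_vector \<Rightarrow>\<^sub>L 'h::real_inner) \<Rightarrow> 'v \<Rightarrow> ('v \<Rightarrow>\<^sub>L real)" where
  "opE j v = blinfun_inner_left (j v) o\<^sub>L j"

definition norm_A :: "('v::real_normed_vector \<Rightarrow>\<^sub>L ('v \<Rightarrow>\<^sub>L real)) \<Rightarrow> 'v \<Rightarrow> real" where
  "norm_A A v = sqrt (A v v)"

definition norm_A_inv :: "('v::real_normed_vector \<Rightarrow>\<^sub>L ('v \<Rightarrow>\<^sub>L real)) \<Rightarrow> ('v \<Rightarrow>\<^sub>L real) \<Rightarrow> real" where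
  "norm_A_inv A f = sqrt (f (inv (blinfun_apply A) f))"

definition eigenspace ::
  "('v::real_normed_vector \<Rightarrow>\<^sub>L ('v \<Rightarrow>\<^sub>L real)) \<Rightarrow> ('v \<Rightarrow>\<^sub>L 'h::real_inner) \<Rightarrow> real \<Rightarrow> 'v set" where
  "eigenspace A j \<mu> = {v. A v = \<mu> *\<^sub>R opE j v}"

definition is_eigenvalue ::
  "('v::real_normed_vector \<Rightarrow>\<^sub>L ('v \<Rightarrow>\<^sub>L real)) \<Rightarrow> ('v \<Rightarrow>\<^sub>L 'h::real_inner) \<Rightarrow> real \<Rightarrow> bool" where
  "is_eigenvalue A j \<mu> \<longleftrightarrow> (\<exists>v. v \<noteq> 0 \<and> A v = \<mu> *\<^sub>R opE j v)"

definition resolvent_set ::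
  "('v::real_normed_vector \<Rightarrow>\<^sub>L ('v \<Rightarrow>\<^sub>L real)) \<Rightarrow> ('v \<Rightarrow>\<^sub>L 'h::real_inner) \<Rightarrow> real set" where
  "resolvent_set A j =
     {\<mu>. (\<forall>f :: 'h \<Rightarrow>\<^sub>L real. \<exists>!v. A v - \<mu> *\<^sub>R opE j v = f o\<^sub>L j) \<and>
         bounded_linear (\<lambda>f :: 'h \<Rightarrow>\<^sub>L real. THE v. A v - \<mu> *\<^sub>R opE j v = f o\<^sub>L j)}"

definition spectrum ::
  "('v::real_normed_vector \<Rightarrow>\<^sub>L ('v \<Rightarrow>\<^sub>L real)) \<Rightarrow> ('v \<Rightarrow>\<^sub>L 'h::real_inner) \<Rightarrow> real set" where
  "spectrum A j = - resolvent_set A j"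

definition finite_dim :: "'a::real_vector set \<Rightarrow> bool" where
  "finite_dim S \<longleftrightarrow> (\<exists>B. finite B \<and> span B = S)"

definition spectral_assumption ::
  "('v::real_normed_vector \<Rightarrow>\<^sub>L ('v \<Rightarrow>\<^sub>L real)) \<Rightarrow> ('v \<Rightarrow>\<^sub>L 'h::real_inner) \<Rightarrow> nat \<Rightarrow> (nat \<Rightarrow> real) \<Rightarrow> bool"
where
  "spectral_assumption A j N lam \<longleftrightarrow>
     N \<ge> 2 \<and> 0 < lam 1 \<and> strict_mono_on {1..N} lam \<and>
     (\<forall>i\<in>{1..N}. is_eigenvalue A j (lam i) \<and> finite_dim (eigenspace A j (lam i))) \<and>
     (\<exists>\<Lambda>>lam N. \<forall>\<mu> \<in> spectrum A j - lam ` {1..N}. \<Lambda> \<le> \<mu>) \<and>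
     \<not> bdd_above (spectrum A j - lam ` {1..N})"

definition rayleigh ::
  "('v::real_normed_vector \<Rightarrow>\<^sub>L ('v \<Rightarrow>\<^sub>L real)) \<Rightarrow> ('v \<Rightarrow>\<^sub>L 'h::real_inner) \<Rightarrow> 'v \<Rightarrow> real" where
  "rayleigh A j v = A v v / opE j v v"

definition residual ::
  "('v::real_normed_vector \<Rightarrow>\<^sub>L ('v \<Rightarrow>\<^sub>L real)) \<Rightarrow> ('v \<Rightarrow>\<^sub>L 'h::real_inner) \<Rightarrow> 'v \<Rightarrow> real" where
  "residual A j v = norm_A_inv A (A v - rayleigh A j v *\<^sub>R opE j v) / norm_A A v"

definition A_proj :: "('v::real_normed_vector \<Rightarrow>\<^sub>L ('v \<Rightarrow>\<^sub>L real)) \<Rightarrow> 'v set \<Rightarrow> 'v \<Rightarrow> 'v" where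
  "A_proj A W v = (THE p. p \<in> W \<and> (\<forall>w\<in>W. A (v - p) w = 0))"

text \<open>The angle in \<open>[0, \<pi>/2]\<close> whose sine is \<open>\<parallel>v\<^sub>\<bottom>\<parallel>\<^sub>A / \<parallel>v\<parallel>\<^sub>A\<close>.\<close>

definition angle_A :: "('v::real_normed_vector \<Rightarrow>\<^sub>L ('v \<Rightarrow>\<^sub>L real)) \<Rightarrow> 'v \<Rightarrow> 'v set \<Rightarrow> real" where
  "angle_A A v W = arcsin (norm_A A (v - A_proj A W v) / norm_A A v)"

end

theory Submission
  imports Defs
begin

text \<open>
  Since \<open>0\<close> lies in the resolvent set, the equation \<open>A (T u) = E u\<close> defines a solution operator
  \<open>T = A\<^sup>-\<^sup>1 E\<close> on \<open>V\<close>. It is self-adjoint and positive for the scalar product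
  \<open>B u w = \<langle>A u, w\<rangle>\<close>, since \<open>B (T u) w = (u, w)\<close>. Eigenvectors of the pencil for \<open>\<mu>\<close> are
  eigenvectors of \<open>T\<close> for \<open>1 / \<mu>\<close>, and \<open>T - m\<close> is invertible as soon as \<open>1 / m\<close> is in the resolvent
  set. So \<open>T\<close> has no positive spectrum above \<open>b = 1 / \<lambda>\<^sub>2\<close> except for \<open>a = 1 / \<lambda>\<^sub>1\<close>.

  The heart of the matter is to turn this information on the spectrum into an inequality:
  \<open>v = p + q\<close> with \<open>p\<close> in the first eigenspace, \<open>q\<close> orthogonal to it, and
  \<open>(q, q) \<le> B q q / \<lambda>\<^sub>2\<close>. This is the spectral theorem in miniature, and the
  following argument replaces it. A lower bound \<open>n\<close> of the quadratic form of a self-adjoint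
  operator \<open>P\<close> can be enlarged whenever \<open>P - n\<close> is bounded below
  (\<open>lower_bound_across_gap\<close>), because the Cauchy--Schwarz inequality for the semidefinite form of
  \<open>P - n\<close> makes \<open>P - n\<close> coercive. Applied to \<open>- T\<close> this gives \<open>T \<le> a\<close>; applied to
  \<open>(T - (a + b) / 2)\<^sup>2\<close> it gives \<open>(T - a) (T - b) \<ge> 0\<close>. With \<open>S = a - T\<close> and \<open>\<delta> = a - b\<close> these say
  \<open>S \<ge> 0\<close> and \<open>S\<^sup>2 \<ge> \<delta> S\<close>, and another Cauchy--Schwarz inequality yields \<open>S \<ge> \<delta>\<close> on the range
  of \<open>S\<close>. Solving \<open>S y + t y = v\<close> and letting \<open>t\<close> tend to \<open>0\<close> splits \<open>v\<close> into a part in the kernel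
  of \<open>S\<close> and a limit \<open>q\<close> of elements of the range (\<open>kernel_decomposition\<close>). This also supplies the
  orthogonal projection that the definition of the angle refers to.

  Write \<open>\<alpha> = B p p\<close>, \<open>\<beta> = B q q\<close>, \<open>g = (q, q)\<close> and \<open>\<lambda>\<close> for the Rayleigh quotient of \<open>v\<close>. Its
  definition reads \<open>(\<lambda> / \<lambda>\<^sub>1 - 1) \<alpha> = \<beta> - \<lambda> g\<close>, and \<open>g \<le> \<beta> / \<lambda>\<^sub>2\<close>. All three
  bounds follow (\<open>eigenvector_error_bounds\<close>), because the residual is the \<open>B\<close>-norm of
  \<open>v - \<lambda> T v = (1 - \<lambda> / \<lambda>\<^sub>1) p + (q - \<lambda> T q)\<close>, an orthogonal sum.
\<close>

section \<open>Self-adjoint operators for a coercive symmetric form\<close>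

locale coercive_form =
  bounded_bilinear B for B :: "'v::banach \<Rightarrow> 'v \<Rightarrow> real" +
  fixes \<sigma> :: real
  assumes sym: "B x y = B y x"
    and \<sigma>_pos: "0 < \<sigma>"
    and coercive: "\<sigma> * (norm x)\<^sup>2 \<le> B x x"
begin

lemmas form_simps = add_left add_right diff_left diff_right scaleR_left scaleR_right
  minus_left minus_right zero_left zero_right

lemma form_nonneg [simp]: "0 \<le> B x x"
  using coercive[of x] \<sigma>_pos by (smt (verit) mult_nonneg_nonneg zero_le_power2)

lemma form_eq_0_iff [simp]: "B x x = 0 \<longleftrightarrow> x = 0"
proof
  assume "B x x = 0"
  then have "\<sigma> * (norm x)\<^sup>2 \<le> 0" using coercive[of x] by simp
  with \<sigma>_pos have "(norm x)\<^sup>2 \<le> 0" by (simp add: mult_le_0_iff)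
  then show "x = 0" by simp
qed (simp add: form_simps)

lemma form_pos: "x \<noteq> 0 \<Longrightarrow> 0 < B x x"
  using form_nonneg[of x] form_eq_0_iff[of x] by linarith

lemma eq_if_form_eq:
  assumes "\<And>y. B x y = B z y"
  shows "x = z"
proof -
  have "B (x - z) (x - z) = 0" using assms[of "x - z"] by (simp add: diff_left)
  then show ?thesis by simp
qed

text \<open>
  This symmetry alone forces \<open>P\<close> to be linear, since \<open>B\<close> is nondegenerate.
\<close>

definition selfadjoint :: "('v \<Rightarrow> 'v) \<Rightarrow> bool" where
  "selfadjoint P \<longleftrightarrow> (\<forall>x y. B (P x) y = B x (P y))"

lemma selfadjointD: "selfadjoint P \<Longrightarrow> B (P x) y = B x (P y)"
  by (simp add: selfadjoint_def)

lemma selfadjoint_add: "selfadjoint P \<Longrightarrow> P (x + y) = P x + P y"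
  by (rule eq_if_form_eq) (simp add: selfadjointD form_simps)

lemma selfadjoint_scaleR: "selfadjoint P \<Longrightarrow> P (c *\<^sub>R x) = c *\<^sub>R P x"
  by (rule eq_if_form_eq) (simp add: selfadjointD form_simps)

lemma selfadjoint_diff: "selfadjoint P \<Longrightarrow> P (x - y) = P x - P y"
  by (rule eq_if_form_eq) (simp add: selfadjointD form_simps)

lemma selfadjoint_shift: "selfadjoint P \<Longrightarrow> selfadjoint (\<lambda>x. P x - c *\<^sub>R x)"
  by (simp add: selfadjoint_def form_simps)

lemma selfadjoint_uminus: "selfadjoint P \<Longrightarrow> selfadjoint (\<lambda>x. - P x)"
  by (simp add: selfadjoint_def form_simps)

lemma selfadjoint_square: "selfadjoint P \<Longrightarrow> selfadjoint (\<lambda>x. P (P x))"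
  by (simp add: selfadjoint_def)

text \<open>
  The quadratic polynomial \<open>s\<^sup>2 c + 2 s t b + t\<^sup>2 d\<close>, the value of the form at \<open>s x + t y\<close>, is
  nonnegative. Choosing \<open>(s, t)\<close> as \<open>(d, - b)\<close> and \<open>(- b, c)\<close> gives the discriminant inequality
  multiplied by \<open>d\<close> and by \<open>c\<close>; only the case \<open>c = d = 0\<close> needs a third choice.
\<close>

lemma semidefinite_Cauchy_Schwarz:
  assumes P: "selfadjoint P" and nonneg: "\<And>x. 0 \<le> B (P x) x"
  shows "(B (P x) y)\<^sup>2 \<le> B (P x) x * B (P y) y"
proof -
  define b c d where "b = B (P x) y" and "c = B (P x) x" and "d = B (P y) y"
  have b': "B (P y) x = b"
    using selfadjointD[OF P, of y x] sym[of y "P x"] by (simp add: b_def)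
  have expand: "B (P (s *\<^sub>R x + t *\<^sub>R y)) (s *\<^sub>R x + t *\<^sub>R y) = s\<^sup>2 * c + 2 * s * t * b + t\<^sup>2 * d"
    for s t
    by (simp add: selfadjoint_add[OF P] selfadjoint_scaleR[OF P] form_simps b'
        flip: b_def c_def d_def) (simp add: algebra_simps power2_eq_square)
  have quad: "0 \<le> s\<^sup>2 * c + 2 * s * t * b + t\<^sup>2 * d" for s t
    using nonneg[of "s *\<^sub>R x + t *\<^sub>R y"] unfolding expand .
  have cd: "0 \<le> c" "0 \<le> d" using nonneg by (auto simp: c_def d_def)
  have "b\<^sup>2 \<le> c * d"
  proof -
    have 1: "0 \<le> d * (c * d - b\<^sup>2)"
      using quad[of d "- b"] by (simp add: algebra_simps power2_eq_square)
    have 2: "0 \<le> c * (c * d - b\<^sup>2)"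
      using quad[of "- b" c] by (simp add: algebra_simps power2_eq_square)
    show ?thesis
    proof (cases "c = 0 \<and> d = 0")
      case True
      then have "0 \<le> - 2 * b\<^sup>2" using quad[of 1 "- b"] by (simp add: power2_eq_square)
      then show ?thesis using True by simp
    next
      case False
      with cd have "0 < c \<or> 0 < d" by linarith
      then show ?thesis using 1 2 by (auto simp: zero_le_mult_iff)
    qed
  qed
  then show ?thesis by (simp add: b_def c_def d_def)
qed

lemma form_Cauchy_Schwarz: "(B x y)\<^sup>2 \<le> B x x * B y y"
  using semidefinite_Cauchy_Schwarz[of "\<lambda>x. x" x y] by (simp add: selfadjoint_def)

text \<open>
  For a positive operator \<open>P\<^sup>2 \<le> M P\<close>: the Cauchy--Schwarz inequality of the form of \<open>P\<close> at \<open>x\<close>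
  and \<open>P x\<close>, divided by \<open>B (P x) (P x)\<close>.
\<close>

lemma semidefinite_image_bound:
  assumes P: "selfadjoint P" and nonneg: "\<And>x. 0 \<le> B (P x) x"
    and upper: "\<And>x. B (P x) x \<le> M * B x x"
  shows "B (P x) (P x) \<le> M * B (P x) x"
proof (cases "P x = 0")
  case True
  then show ?thesis by (simp add: form_simps)
next
  case False
  define n where "n = B (P x) (P x)"
  have n: "0 < n" using form_pos[OF False] by (simp add: n_def)
  have "n * n \<le> B (P x) x * B (P (P x)) (P x)"
    using semidefinite_Cauchy_Schwarz[OF P nonneg, of x "P x"] by (simp add: n_def power2_eq_square)
  also have "\<dots> \<le> B (P x) x * (M * n)"
    using upper[of "P x"] nonneg[of x] by (simp add: n_def mult_left_mono)
  finally have "n * n \<le> (M * B (P x) x) * n" by (simp add: algebra_simps)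
  then show ?thesis using n by (simp add: n_def)
qed

section \<open>Gaps in the spectrum\<close>

text \<open>
  For a self-adjoint operator this is the invertibility of \<open>P\<close>; in this form the absence of
  spectrum at a point enters the estimates.
\<close>

definition bounded_below :: "('v \<Rightarrow> 'v) \<Rightarrow> bool" where
  "bounded_below P \<longleftrightarrow> (\<exists>k>0. \<forall>x. k * B x x \<le> B (P x) (P x))"

lemma bounded_below_compose:
  assumes "bounded_below P" "bounded_below Q"
  shows "bounded_below (\<lambda>x. P (Q x))"
proof -
  obtain k l where "0 < k" and k: "\<And>x. k * B x x \<le> B (P x) (P x)"
    and "0 < l" and l: "\<And>x. l * B x x \<le> B (Q x) (Q x)"
    using assms unfolding bounded_below_def by blast
  have "k * l * B x x \<le> B (P (Q x)) (P (Q x))" for x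
  proof -
    have "k * (l * B x x) \<le> k * B (Q x) (Q x)" using l \<open>0 < k\<close> by simp
    also have "\<dots> \<le> B (P (Q x)) (P (Q x))" by (rule k)
    finally show ?thesis by (simp add: mult.assoc)
  qed
  then show ?thesis unfolding bounded_below_def using \<open>0 < k\<close> \<open>0 < l\<close>
    by (intro exI[of _ "k * l"]) simp
qed

text \<open>
  Passage from the norm of \<open>V\<close>, in which resolvents are bounded, to the equivalent norm given by \<open>B\<close>.
\<close>

lemma bounded_below_if_norm_bound:
  assumes "\<And>x. norm x \<le> C * norm (P x)"
  shows "bounded_below P"
proof -
  obtain K where "0 < K" and K: "\<And>x y. norm (B x y) \<le> norm x * norm y * K"
    using pos_bounded by blast
  define D where "D = K * C\<^sup>2 + \<sigma>"
  have "0 < D" using \<open>0 < K\<close> \<sigma>_pos by (simp add: D_def add_nonneg_pos)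
  have "\<sigma> / D * B x x \<le> B (P x) (P x)" for x
  proof -
    have "(norm x)\<^sup>2 \<le> (C * norm (P x))\<^sup>2" using assms[of x] by (intro power_mono) auto
    then have "K * (norm x)\<^sup>2 \<le> K * (C\<^sup>2 * (norm (P x))\<^sup>2)"
      using \<open>0 < K\<close> by (simp add: power_mult_distrib)
    moreover have "B x x \<le> K * (norm x)\<^sup>2"
      using K[of x x] by (simp add: power2_eq_square algebra_simps)
    moreover have "K * (C\<^sup>2 * (norm (P x))\<^sup>2) \<le> D * (norm (P x))\<^sup>2"
      using \<sigma>_pos by (simp add: D_def algebra_simps)
    ultimately have "B x x \<le> D * (norm (P x))\<^sup>2" by linarith
    then have "\<sigma> * B x x \<le> D * (\<sigma> * (norm (P x))\<^sup>2)" using \<sigma>_pos by (simp add: algebra_simps)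
    also have "\<dots> \<le> D * B (P x) (P x)" using coercive[of "P x"] \<open>0 < D\<close> by simp
    finally show ?thesis using \<open>0 < D\<close> by (simp add: field_simps)
  qed
  then show ?thesis unfolding bounded_below_def using \<open>0 < D\<close> \<sigma>_pos
    by (intro exI[of _ "\<sigma> / D"]) simp
qed

text \<open>
  The infimum of the numerical range of a self-adjoint operator is in its spectrum, hence cannot lie
  in a gap \<open>[n\<^sub>0, n\<^sub>1)\<close>. Indeed, let \<open>n < n\<^sub>1\<close> be the best lower bound and \<open>Q = P - n \<ge> 0\<close>. Then
  \<open>k B x x \<le> B (Q x) (Q x) \<le> K B (Q x) x\<close>, by boundedness below and
  \<open>semidefinite_image_bound\<close>, so \<open>n + k / K\<close> is a lower bound as well.
\<close>

lemma lower_bound_across_gap: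
  assumes P: "selfadjoint P"
    and start: "\<And>x. n\<^sub>0 * B x x \<le> B (P x) x"
    and upper: "\<And>x. B (P x) x \<le> M * B x x"
    and gap: "\<And>n. \<lbrakk>n\<^sub>0 \<le> n; n < n\<^sub>1\<rbrakk> \<Longrightarrow> bounded_below (\<lambda>x. P x - n *\<^sub>R x)"
  shows "n\<^sub>1 * B x x \<le> B (P x) x"
proof (rule ccontr)
  assume less: "\<not> ?thesis"
  define G where "G = {n. n\<^sub>0 \<le> n \<and> (\<forall>x. n * B x x \<le> B (P x) x)}"
  define n where "n = Sup G"
  have "x \<noteq> 0" using less by (auto simp: form_simps)
  have n0: "n\<^sub>0 \<in> G" using start by (simp add: G_def)
  have le: "m \<le> B (P y) y / B y y" if "m \<in> G" "y \<noteq> 0" for m y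
    using that form_pos[OF that(2)] by (simp add: G_def pos_le_divide_eq)
  have bdd: "bdd_above G" using le[OF _ \<open>x \<noteq> 0\<close>] by (rule bdd_aboveI)
  have n_le: "n \<le> B (P y) y / B y y" if "y \<noteq> 0" for y
    unfolding n_def using n0 le[OF _ that] by (intro cSup_least) auto
  have "n\<^sub>0 \<le> n" unfolding n_def using n0 bdd by (rule cSup_upper)
  have "n < n\<^sub>1"
  proof -
    have "B (P x) x / B x x < n\<^sub>1"
      using less form_pos[OF \<open>x \<noteq> 0\<close>] by (simp add: pos_divide_less_eq)
    then show ?thesis using n_le[OF \<open>x \<noteq> 0\<close>] by linarith
  qed
  define Q where "Q y = P y - n *\<^sub>R y" for y
  have Q: "selfadjoint Q" unfolding Q_def by (rule selfadjoint_shift[OF P])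
  have Q_form: "B (Q y) y = B (P y) y - n * B y y" for y by (simp add: Q_def form_simps)
  have Q_nonneg: "0 \<le> B (Q y) y" for y
    using n_le[of y] form_pos[of y] by (cases "y = 0") (auto simp: Q_form form_simps pos_le_divide_eq)
  define K where "K = \<bar>M - n\<bar> + 1"
  have "0 < K" by (simp add: K_def)
  have "B (Q y) y \<le> K * B y y" for y
  proof -
    have "B (Q y) y \<le> (M - n) * B y y" using upper[of y] by (simp add: Q_form algebra_simps)
    also have "\<dots> \<le> K * B y y" by (intro mult_right_mono) (auto simp: K_def)
    finally show ?thesis .
  qed
  note image = semidefinite_image_bound[OF Q Q_nonneg this]
  obtain k where "0 < k" and k: "\<And>y. k * B y y \<le> B (Q y) (Q y)"
    using gap[OF \<open>n\<^sub>0 \<le> n\<close> \<open>n < n\<^sub>1\<close>] unfolding bounded_below_def Q_def by blast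
  have "(n + k / K) * B y y \<le> B (P y) y" for y
  proof -
    have "k * B y y \<le> K * B (Q y) y" using k[of y] image[of y] by linarith
    then have "k / K * B y y \<le> B (Q y) y" using \<open>0 < K\<close> by (simp add: field_simps)
    then show ?thesis by (simp add: Q_form algebra_simps)
  qed
  then have "n + k / K \<in> G"
    using \<open>n\<^sub>0 \<le> n\<close> \<open>0 < k\<close> \<open>0 < K\<close> by (auto simp: G_def intro: add_increasing2)
  then have "n + k / K \<le> n" unfolding n_def using bdd by (rule cSup_upper)
  then show False using divide_pos_pos[OF \<open>0 < k\<close> \<open>0 < K\<close>] by linarith
qed

lemma top_of_spectrum_bound:
  assumes T: "selfadjoint T" and upper: "\<And>x. B (T x) x \<le> M * B x x"
    and lower: "\<And>x. 0 \<le> B (T x) x"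
    and above: "\<And>m. a < m \<Longrightarrow> bounded_below (\<lambda>x. T x - m *\<^sub>R x)"
  shows "B (T x) x \<le> a * B x x"
proof -
  have neg: "bounded_below (\<lambda>x. - T x - n *\<^sub>R x)" if "n < - a" for n
  proof -
    have "B (T x - (- n) *\<^sub>R x) (T x - (- n) *\<^sub>R x) = B (- T x - n *\<^sub>R x) (- T x - n *\<^sub>R x)" for x
      by (simp add: form_simps algebra_simps)
    then show ?thesis using above[of "- n"] that unfolding bounded_below_def by simp
  qed
  have "- a * B x x \<le> B (- T x) x"
    by (rule lower_bound_across_gap[OF selfadjoint_uminus[OF T], where n\<^sub>0 = "- M" and M = 0])
      (auto simp: form_simps upper lower intro!: neg)
  then show ?thesis by (simp add: form_simps)
qed

text \<open>
  If \<open>T\<close> has no spectrum in \<open>(b, a)\<close>, then \<open>(T - a) (T - b) \<ge> 0\<close>. With \<open>c\<close> the midpoint and \<open>r\<close> half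
  the length of the gap, this product is \<open>(T - c)\<^sup>2 - r\<^sup>2\<close>. The lower bound \<open>0\<close> of \<open>(T - c)\<^sup>2\<close>
  improves to \<open>r\<^sup>2\<close>, since \<open>(T - c)\<^sup>2 - s\<^sup>2\<close> is the product of \<open>T - (c + s)\<close> and \<open>T - (c - s)\<close>, both
  invertible for \<open>s < r\<close>.
\<close>

lemma spectral_gap_product_nonneg:
  assumes T: "selfadjoint T" and upper: "\<And>x. B (T x) x \<le> M * B x x"
    and lower: "\<And>x. 0 \<le> B (T x) x" and "b < a"
    and gap: "\<And>m. \<lbrakk>b < m; m < a\<rbrakk> \<Longrightarrow> bounded_below (\<lambda>x. T x - m *\<^sub>R x)"
  shows "0 \<le> B (T x - a *\<^sub>R x) (T x - b *\<^sub>R x)"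
proof -
  define c r where "c = (a + b) / 2" and "r = (a - b) / 2"
  have "0 < r" using \<open>b < a\<close> by (simp add: r_def)
  define P where "P x = T x - c *\<^sub>R x" for x
  have P: "selfadjoint P" unfolding P_def by (rule selfadjoint_shift[OF T])
  have PP: "B (P (P x)) x = B (P x) (P x)" for x by (simp add: selfadjointD[OF P])
  have "r\<^sup>2 * B x x \<le> B (P (P x)) x"
  proof (rule lower_bound_across_gap[where n\<^sub>0 = 0 and M = "M\<^sup>2 + c\<^sup>2 + 2 * \<bar>c\<bar> * \<bar>M\<bar>"])
    show "selfadjoint (\<lambda>x. P (P x))" by (rule selfadjoint_square[OF P])
    show "0 * B x x \<le> B (P (P x)) x" for x by (simp add: PP)
    show "B (P (P x)) x \<le> (M\<^sup>2 + c\<^sup>2 + 2 * \<bar>c\<bar> * \<bar>M\<bar>) * B x x" for x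
    proof -
      have Tx: "0 \<le> B (T x) x" "B (T x) x \<le> \<bar>M\<bar> * B x x"
        using lower[of x] upper[of x] mult_right_mono[OF abs_ge_self form_nonneg, of M x]
        by (auto intro: order_trans)
      have "B (T x) (T x) \<le> \<bar>M\<bar> * B (T x) x"
        by (rule semidefinite_image_bound[OF T lower])
          (meson abs_ge_self form_nonneg mult_right_mono order_trans upper)
      also have "\<dots> \<le> \<bar>M\<bar> * (\<bar>M\<bar> * B x x)" using Tx(2) by (rule mult_left_mono) simp
      finally have TT: "B (T x) (T x) \<le> M\<^sup>2 * B x x" by (simp add: power2_eq_square)
      have "- (c * B (T x) x) \<le> \<bar>c\<bar> * B (T x) x"
        using mult_right_mono[of "- c" "\<bar>c\<bar>" "B (T x) x"] Tx(1) by simp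
      also have "\<dots> \<le> \<bar>c\<bar> * (\<bar>M\<bar> * B x x)" using Tx(2) by (rule mult_left_mono) simp
      finally have cT: "- (c * B (T x) x) \<le> \<bar>c\<bar> * (\<bar>M\<bar> * B x x)" .
      have "B (P (P x)) x = B (T x) (T x) - 2 * (c * B (T x) x) + c\<^sup>2 * B x x"
        unfolding PP by (simp add: P_def form_simps sym[of x "T x"] power2_eq_square algebra_simps)
      with TT cT show ?thesis by (simp add: algebra_simps)
    qed
    show "bounded_below (\<lambda>x. P (P x) - n *\<^sub>R x)" if n: "0 \<le> n" "n < r\<^sup>2" for n
    proof -
      define s where "s = sqrt n"
      have s: "0 \<le> s" "s < r" "s * s = n"
        using n \<open>0 < r\<close> by (auto simp: s_def real_sqrt_less_iff intro: real_less_lsqrt)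
      have low: "bounded_below (\<lambda>x. T x - (c - s) *\<^sub>R x)"
        and high: "bounded_below (\<lambda>x. T x - (c + s) *\<^sub>R x)"
        using s by (auto intro!: gap simp: c_def r_def field_simps)
      have "(T (T x - (c - s) *\<^sub>R x) - (c + s) *\<^sub>R (T x - (c - s) *\<^sub>R x)) = P (P x) - n *\<^sub>R x" for x
        unfolding P_def s(3)[symmetric]
        by (simp add: selfadjoint_diff[OF T] selfadjoint_scaleR[OF T] selfadjoint_add[OF T]
            algebra_simps)
      then show ?thesis using bounded_below_compose[OF high low] by simp
    qed
  qed
  then have "0 \<le> B (P x) (P x) - r\<^sup>2 * B x x" by (simp add: PP)
  also have "\<dots> = B (T x - a *\<^sub>R x) (T x - b *\<^sub>R x)"
    by (simp add: P_def c_def r_def form_simps sym[of x "T x"] field_simps power2_eq_square)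
  finally show ?thesis .
qed

section \<open>Splitting off the top eigenspace\<close>

text \<open>
  If \<open>S \<ge> 0\<close> and \<open>S\<^sup>2 \<ge> \<delta> S\<close>, then \<open>S \<ge> \<delta>\<close> on the orthogonal complement of its kernel.
  On the range this is the Cauchy--Schwarz inequality of the form of \<open>S\<close>:
  \<open>B (S y) (S y)\<^sup>2 \<le> B (S y) y * B (S (S y)) (S y)\<close>, where the first factor is at most
  \<open>B (S y) (S y) / \<delta>\<close>. To reach the complement, let \<open>S y\<^sub>n + t\<^sub>n y\<^sub>n = x\<close> with \<open>t\<^sub>n \<rightarrow> 0\<close>. The range
  parts \<open>r\<^sub>n = S y\<^sub>n\<close> are bounded, so \<open>S r\<^sub>n = S x - t\<^sub>n r\<^sub>n\<close> converges; as \<open>S\<close> is bounded below on its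
  range, \<open>r\<^sub>n\<close> is a Cauchy sequence, and its limit \<open>q\<close> is the component of \<open>x\<close> orthogonal to the
  kernel.
\<close>

lemma kernel_decomposition:
  assumes S: "selfadjoint S" and nonneg: "\<And>x. 0 \<le> B (S x) x"
    and "0 < \<delta>" and gap: "\<And>x. \<delta> * B (S x) x \<le> B (S x) (S x)"
    and surj: "\<And>t x. 0 < t \<Longrightarrow> \<exists>y. S y + t *\<^sub>R y = x"
  obtains p q where "x = p + q" "S p = 0" "\<And>e. S e = 0 \<Longrightarrow> B q e = 0" "\<delta> * B q q \<le> B (S q) q"
proof -
  have range: "\<delta> * B (S y) (S y) \<le> B (S (S y)) (S y)" for y
  proof (cases "S y = 0")
    case True
    then show ?thesis by (simp add: form_simps)
  next
    case False
    define m where "m = B (S y) (S y)"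
    have "0 < m" using form_pos[OF False] by (simp add: m_def)
    have "\<delta> * (m * m) \<le> \<delta> * (B (S y) y * B (S (S y)) (S y))"
      using semidefinite_Cauchy_Schwarz[OF S nonneg, of y "S y"] \<open>0 < \<delta>\<close>
      by (simp add: m_def power2_eq_square)
    also have "\<dots> = (\<delta> * B (S y) y) * B (S (S y)) (S y)" by simp
    also have "\<dots> \<le> m * B (S (S y)) (S y)"
      unfolding m_def by (intro mult_right_mono gap nonneg)
    finally have "m * (\<delta> * m) \<le> m * B (S (S y)) (S y)" by (simp add: algebra_simps)
    then show ?thesis using \<open>0 < m\<close> by (simp add: m_def)
  qed
  obtain K where "0 < K" and K: "\<And>x y. norm (B x y) \<le> norm x * norm y * K"
    using pos_bounded by blast
  define C where "C = K / (\<delta> * \<sigma>)"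
  have "0 < C" using \<open>0 < K\<close> \<open>0 < \<delta>\<close> \<sigma>_pos by (simp add: C_def)
  have range_norm: "norm (S y) \<le> C * norm (S (S y))" for y
  proof (cases "S y = 0")
    case True
    then show ?thesis using \<open>0 < C\<close> by simp
  next
    case False
    have "\<delta> * (\<sigma> * (norm (S y))\<^sup>2) \<le> \<delta> * B (S y) (S y)"
      using coercive[of "S y"] \<open>0 < \<delta>\<close> by simp
    also have "\<dots> \<le> norm (S (S y)) * norm (S y) * K"
      using range[of y] K[of "S (S y)" "S y"] by simp
    finally have "norm (S y) * (\<delta> * \<sigma> * norm (S y)) \<le> norm (S y) * (K * norm (S (S y)))"
      by (simp add: power2_eq_square algebra_simps)
    then have "\<delta> * \<sigma> * norm (S y) \<le> K * norm (S (S y))" using False by simp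
    then show ?thesis using \<open>0 < \<delta>\<close> \<sigma>_pos by (simp add: C_def field_simps)
  qed
  define t :: "nat \<Rightarrow> real" where "t n = 1 / real (Suc n)" for n
  have t_pos: "0 < t n" for n by (simp add: t_def)
  have "\<forall>n. \<exists>y. S y + t n *\<^sub>R y = x" using surj[OF t_pos] by blast
  then have "\<exists>y. \<forall>n. S (y n) + t n *\<^sub>R y n = x" by (rule choice)
  then obtain y where y: "\<And>n. S (y n) + t n *\<^sub>R y n = x" by blast
  define r where "r n = S (y n)" for n
  have r: "x = r n + t n *\<^sub>R y n" for n using y[of n] by (simp add: r_def)
  have r_form: "B (r n) (r n) \<le> B x x" for n
  proof -
    have "B x x = B (r n) (r n) + 2 * (t n * B (S (y n)) (y n)) + t n * (t n * B (y n) (y n))"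
      by (subst (1 2) r[of n]) (simp add: form_simps sym[of "y n" "r n"], simp add: r_def distrib_left)
    then show ?thesis using t_pos[of n] nonneg[of "y n"] by simp
  qed
  have r_bound: "norm (r n) \<le> sqrt (B x x / \<sigma>)" for n
  proof -
    have "\<sigma> * (norm (r n))\<^sup>2 \<le> B x x" using coercive[of "r n"] r_form[of n] by linarith
    then have "(norm (r n))\<^sup>2 \<le> B x x / \<sigma>" using \<sigma>_pos by (simp add: field_simps)
    then show ?thesis by (simp add: real_le_rsqrt)
  qed
  have t_lim: "t \<longlonglongrightarrow> 0"
    unfolding t_def by (rule lim_1_over_n[THEN LIMSEQ_Suc])
  have tr: "(\<lambda>n. t n *\<^sub>R r n) \<longlonglongrightarrow> 0"
    by (rule lim_null_scaleR_bounded[OF t_lim, where B = "sqrt (B x x / \<sigma>)"]) (simp add: r_bound)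
  have Sr: "S (r n) = S x - t n *\<^sub>R r n" for n
    using arg_cong[OF r[of n], of S]
    by (simp add: selfadjoint_add[OF S] selfadjoint_scaleR[OF S] r_def)
  have Sr_lim: "(\<lambda>n. S (r n)) \<longlonglongrightarrow> S x"
    unfolding Sr using tendsto_diff[OF tendsto_const tr, of "S x"] by simp
  have "Cauchy r"
  proof (rule metric_CauchyI)
    fix \<epsilon> :: real assume "0 < \<epsilon>"
    then have "0 < \<epsilon> / C" using \<open>0 < C\<close> by simp
    then obtain M where M: "\<And>m n. \<lbrakk>m \<ge> M; n \<ge> M\<rbrakk> \<Longrightarrow> dist (S (r m)) (S (r n)) < \<epsilon> / C"
      using LIMSEQ_imp_Cauchy[OF Sr_lim] unfolding Cauchy_def by blast
    have "dist (r m) (r n) < \<epsilon>" if "m \<ge> M" "n \<ge> M" for m n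
    proof -
      have "norm (r m - r n) \<le> C * norm (S (r m) - S (r n))"
        using range_norm[of "y m - y n"] by (simp add: selfadjoint_diff[OF S] r_def)
      also have "\<dots> < C * (\<epsilon> / C)"
        using M[OF that] \<open>0 < C\<close> unfolding dist_norm by (intro mult_strict_left_mono)
      finally show ?thesis using \<open>0 < C\<close> by (simp add: dist_norm)
    qed
    then show "\<exists>M. \<forall>m\<ge>M. \<forall>n\<ge>M. dist (r m) (r n) < \<epsilon>" by blast
  qed
  then obtain q where q: "r \<longlonglongrightarrow> q" by (auto simp: convergent_eq_Cauchy[symmetric])
  \<comment> \<open>Self-adjointness moves \<open>S\<close> to the fixed argument, where convergence of \<open>r\<close> suffices.\<close>
  have Sq: "S q = S x"
  proof (rule eq_if_form_eq)
    fix e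
    have "(\<lambda>n. B (r n) (S e)) \<longlonglongrightarrow> B q (S e)" by (intro tendsto tendsto_const q)
    moreover have "(\<lambda>n. B (r n) (S e)) \<longlonglongrightarrow> B (S x) e"
      unfolding selfadjointD[OF S, symmetric] by (intro tendsto tendsto_const Sr_lim)
    ultimately have "B q (S e) = B (S x) e" by (rule LIMSEQ_unique)
    then show "B (S q) e = B (S x) e" by (simp add: selfadjointD[OF S])
  qed
  have "x = (x - q) + q" by simp
  moreover have "S (x - q) = 0" by (simp add: selfadjoint_diff[OF S] Sq)
  moreover have "B q e = 0" if "S e = 0" for e
  proof -
    have "B (r n) e = 0" for n
      using that selfadjointD[OF S, of "y n" e] by (simp add: r_def form_simps)
    then show ?thesis
      using tendsto[OF q tendsto_const, of e] by (simp add: LIMSEQ_const_iff)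
  qed
  moreover have "\<delta> * B q q \<le> B (S q) q"
  proof (rule LIMSEQ_le)
    show "(\<lambda>n. \<delta> * B (r n) (r n)) \<longlonglongrightarrow> \<delta> * B q q"
      by (intro tendsto_mult tendsto_const tendsto q)
    show "(\<lambda>n. B (S (r n)) (r n)) \<longlonglongrightarrow> B (S q) q"
      unfolding Sq by (intro tendsto Sr_lim q)
    show "\<exists>N. \<forall>n\<ge>N. \<delta> * B (r n) (r n) \<le> B (S (r n)) (r n)"
      using range by (simp add: r_def)
  qed
  ultimately show thesis by (rule that)
qed

text \<open>
  The two parts of the spectrum of \<open>T\<close>, the point \<open>a\<close> and what lies below \<open>b\<close>, split the
  space: \<open>S = a - T\<close> satisfies \<open>S \<ge> 0\<close> and \<open>S\<^sup>2 \<ge> (a - b) S\<close> by the bounds across gaps, and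
  \<open>S + t\<close> is onto because \<open>a + t\<close> lies above the spectrum.
\<close>

lemma top_eigenspace_decomposition:
  assumes T: "selfadjoint T" and upper: "\<And>x. B (T x) x \<le> M * B x x"
    and lower: "\<And>x. 0 \<le> B (T x) x" and "b < a"
    and above: "\<And>m. a < m \<Longrightarrow> bounded_below (\<lambda>x. T x - m *\<^sub>R x)"
    and surj: "\<And>m x. a < m \<Longrightarrow> \<exists>y. T y - m *\<^sub>R y = x"
    and gap: "\<And>m. \<lbrakk>b < m; m < a\<rbrakk> \<Longrightarrow> bounded_below (\<lambda>x. T x - m *\<^sub>R x)"
  obtains p q where "x = p + q" "T p = a *\<^sub>R p" "\<And>e. T e = a *\<^sub>R e \<Longrightarrow> B q e = 0"
    "B (T q) q \<le> b * B q q"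
proof -
  define S where "S x = a *\<^sub>R x - T x" for x
  have S: "selfadjoint S"
    using T by (simp add: S_def selfadjoint_def form_simps)
  have S_nonneg: "0 \<le> B (S x) x" for x
    using top_of_spectrum_bound[OF T upper lower above] by (simp add: S_def form_simps)
  have S_gap: "(a - b) * B (S x) x \<le> B (S x) (S x)" for x
  proof -
    have "B (S x) (S x) - (a - b) * B (S x) x = B (T x - a *\<^sub>R x) (T x - b *\<^sub>R x)"
      by (simp add: S_def form_simps sym[of x "T x"] algebra_simps)
    then show ?thesis using spectral_gap_product_nonneg[OF T upper lower \<open>b < a\<close> gap, of x] by simp
  qed
  have S_surj: "\<exists>y. S y + t *\<^sub>R y = x" if "0 < t" for t x
  proof -
    obtain y where "T y - (a + t) *\<^sub>R y = - x" using surj[of "a + t" "- x"] \<open>0 < t\<close> by auto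
    then have "S y + t *\<^sub>R y = x"
      by (simp add: S_def algebra_simps)
    then show ?thesis by blast
  qed
  have "0 < a - b" using \<open>b < a\<close> by simp
  from kernel_decomposition[OF S S_nonneg this S_gap S_surj, of x]
  obtain p q where pq: "x = p + q" "S p = 0" "\<And>e. S e = 0 \<Longrightarrow> B q e = 0" 
    "(a - b) * B q q \<le> B (S q) q" by blast
  show thesis
  proof (rule that[OF pq(1)])
    show "T p = a *\<^sub>R p" using pq(2) by (simp add: S_def)
    show "B q e = 0" if "T e = a *\<^sub>R e" for e using pq(3)[of e] that by (simp add: S_def)
    show "B (T q) q \<le> b * B q q" using pq(4) by (simp add: S_def form_simps algebra_simps)
  qed
qed

section \<open>Error bounds from the Rayleigh quotient\<close>

text \<open>
  The fact \<open>balance\<close> is the defining equation of the Rayleigh quotient \<open>l\<close>. The first bound is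
  \<open>balance\<close> together with \<open>l g \<le> (l / l\<^sub>2) \<beta>\<close>. In the second, the residual is the orthogonal sum of
  \<open>(1 - x) p\<close>, with \<open>x = l / l\<^sub>1\<close>, and \<open>d = q - l T q\<close>; the first summand is of the order of \<open>q\<close> since
  \<open>(x - 1)\<^sup>2 \<alpha> \<le> (x - 1) \<beta>\<close> by \<open>balance\<close>. In the third, \<open>d\<close> alone controls \<open>q\<close>,
  because \<open>B d q = \<beta> - l g \<ge> (1 - l / l\<^sub>2) \<beta>\<close>.
\<close>

lemma eigenvector_error_bounds:
  assumes T: "selfadjoint T" and lower: "\<And>x. 0 \<le> B (T x) x"
    and upper: "\<And>x. B (T x) x \<le> 1 / l\<^sub>1 * B x x"
    and p: "T p = (1 / l\<^sub>1) *\<^sub>R p" and q: "B (T q) q \<le> 1 / l\<^sub>2 * B q q" and qp: "B q p = 0"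
    and v: "v = p + q" and l: "0 < l\<^sub>1" "l\<^sub>1 \<le> l" "l < l\<^sub>2" and quotient: "B v v = l * B (T v) v"
  shows "B q q \<le> l\<^sub>2 / l\<^sub>1 * ((l - l\<^sub>1) / (l\<^sub>2 - l)) * B v v"
    and "B (v - l *\<^sub>R T v) (v - l *\<^sub>R T v) \<le> (3 * l / l\<^sub>1)\<^sup>2 * B q q"
    and "B q q \<le> (l\<^sub>2 / (l\<^sub>2 - l))\<^sup>2 * B (v - l *\<^sub>R T v) (v - l *\<^sub>R T v)"
proof -
  define \<alpha> \<beta> g where "\<alpha> = B p p" and "\<beta> = B q q" and "g = B (T q) q"
  define x where "x = l / l\<^sub>1"
  define d where "d = q - l *\<^sub>R T q"
  have x: "1 \<le> x" using l by (simp add: x_def)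
  have nonneg: "0 \<le> \<alpha>" "0 \<le> \<beta>" "0 \<le> g" using lower by (auto simp: \<alpha>_def \<beta>_def g_def)
  have pq: "B p q = 0" using qp sym by metis
  have Tqp: "B (T q) p = 0" using selfadjointD[OF T, of q p] by (simp add: p form_simps qp)
  have Tqq: "B q (T q) = g" using sym by (simp add: g_def)
  have vv: "B v v = \<alpha> + \<beta>" by (simp add: v form_simps qp pq \<alpha>_def \<beta>_def)
  have Tvv: "B (T v) v = \<alpha> / l\<^sub>1 + g"
    by (simp add: v selfadjoint_add[OF T] p form_simps qp pq Tqp \<alpha>_def g_def)
  have balance: "(x - 1) * \<alpha> = \<beta> - l * g"
    using quotient unfolding vv Tvv x_def by (simp add: algebra_simps)
  have lg: "l * g \<le> l / l\<^sub>2 * \<beta>"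
    using mult_left_mono[OF q, of l] l by (simp add: g_def \<beta>_def)
  have gap: "(1 - l / l\<^sub>2) * \<beta> \<le> \<beta> - l * g" using lg by (simp add: algebra_simps)
  have gap_pos: "0 < 1 - l / l\<^sub>2" using l by simp
  have "(1 - l / l\<^sub>2) * \<beta> \<le> (x - 1) * (\<alpha> + \<beta>)"
    using gap balance mult_nonneg_nonneg[of "x - 1" \<beta>] x nonneg by (simp add: algebra_simps)
  then have "\<beta> \<le> (x - 1) / (1 - l / l\<^sub>2) * (\<alpha> + \<beta>)"
    using gap_pos by (simp add: field_simps)
  also have "(x - 1) / (1 - l / l\<^sub>2) = l\<^sub>2 / l\<^sub>1 * ((l - l\<^sub>1) / (l\<^sub>2 - l))"
    using l by (simp add: x_def field_simps)
  finally show "B q q \<le> l\<^sub>2 / l\<^sub>1 * ((l - l\<^sub>1) / (l\<^sub>2 - l)) * B v v" by (simp add: vv \<beta>_def)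
  have "B p d = 0"
    using sym[of p "T q"] by (simp add: d_def form_simps pq Tqp)
  have "v - l *\<^sub>R T v = (1 - x) *\<^sub>R p + d"
    by (simp add: v selfadjoint_add[OF T] p d_def x_def algebra_simps)
  then have residual: "B (v - l *\<^sub>R T v) (v - l *\<^sub>R T v) = (x - 1)\<^sup>2 * \<alpha> + B d d"
    using \<open>B p d = 0\<close> sym[of d p]
    by (simp only: \<alpha>_def) (simp add: form_simps power2_eq_square algebra_simps)
  have "B (T q) (T q) \<le> 1 / l\<^sub>1 * B (T q) q"
    by (rule semidefinite_image_bound[OF T lower upper])
  also have "\<dots> \<le> 1 / l\<^sub>1 * (1 / l\<^sub>1 * \<beta>)"
    using upper[of q] l by (intro mult_left_mono) (auto simp: \<beta>_def)
  finally have "l\<^sup>2 * B (T q) (T q) \<le> l\<^sup>2 * (1 / l\<^sub>1 * (1 / l\<^sub>1 * \<beta>))" by (rule mult_left_mono) simp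
  then have "l\<^sup>2 * B (T q) (T q) \<le> x\<^sup>2 * \<beta>" by (simp add: x_def power2_eq_square)
  moreover have "B d d = \<beta> - 2 * (l * g) + l\<^sup>2 * B (T q) (T q)"
    by (simp add: d_def form_simps Tqq \<beta>_def power2_eq_square algebra_simps flip: g_def)
  ultimately have dd: "B d d \<le> \<beta> + x\<^sup>2 * \<beta>" using mult_nonneg_nonneg[of l g] nonneg l by linarith
  have "(x - 1)\<^sup>2 * \<alpha> = (x - 1) * (\<beta> - l * g)"
    using balance by (simp add: power2_eq_square mult.assoc)
  also have "\<dots> \<le> (x - 1) * \<beta>" using x nonneg l by (intro mult_left_mono) auto
  finally have "(x - 1)\<^sup>2 * \<alpha> + B d d \<le> (x + x\<^sup>2) * \<beta>" using dd by (simp add: algebra_simps)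
  also have "\<dots> \<le> (9 * x\<^sup>2) * \<beta>"
  proof (rule mult_right_mono)
    have "x * 1 \<le> x * x" using x by (intro mult_left_mono) auto
    then have "x \<le> x\<^sup>2" by (simp add: power2_eq_square)
    then show "x + x\<^sup>2 \<le> 9 * x\<^sup>2" using x by linarith
  qed (rule nonneg)
  finally show "B (v - l *\<^sub>R T v) (v - l *\<^sub>R T v) \<le> (3 * l / l\<^sub>1)\<^sup>2 * B q q"
    unfolding residual by (simp add: x_def \<beta>_def power_divide power_mult_distrib)
  have "((1 - l / l\<^sub>2) * \<beta>)\<^sup>2 \<le> (B d q)\<^sup>2"
    using gap gap_pos nonneg by (intro power_mono) (auto simp: d_def form_simps \<beta>_def g_def)
  also have "\<dots> \<le> B d d * \<beta>" unfolding \<beta>_def by (rule form_Cauchy_Schwarz)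
  finally have "\<beta> * ((1 - l / l\<^sub>2)\<^sup>2 * \<beta>) \<le> \<beta> * B d d"
    by (simp add: power_mult_distrib power2_eq_square algebra_simps)
  then have "(1 - l / l\<^sub>2)\<^sup>2 * \<beta> \<le> B d d"
    using nonneg(2) by (cases "\<beta> = 0") auto
  also have "\<dots> \<le> B (v - l *\<^sub>R T v) (v - l *\<^sub>R T v)" unfolding residual using nonneg by simp
  finally have "\<beta> \<le> B (v - l *\<^sub>R T v) (v - l *\<^sub>R T v) / (1 - l / l\<^sub>2)\<^sup>2"
    using zero_less_power[OF gap_pos, of 2] by (subst pos_le_divide_eq) (simp_all add: mult.commute)
  also have "(1 - l / l\<^sub>2)\<^sup>2 = ((l\<^sub>2 - l) / l\<^sub>2)\<^sup>2" using l by (simp add: field_simps)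
  finally show "B q q \<le> (l\<^sub>2 / (l\<^sub>2 - l))\<^sup>2 * B (v - l *\<^sub>R T v) (v - l *\<^sub>R T v)"
    by (simp add: \<beta>_def power_divide mult.commute)
qed

end

section \<open>The solution operator of the eigenvalue problem\<close>

lemma coercive_form_if_strongly_positive:
  assumes "symmetric_op A" and "strongly_positive A"
  obtains \<sigma> where "coercive_form (\<lambda>u v. blinfun_apply (blinfun_apply A u) v) \<sigma>"
proof -
  obtain \<sigma> where "0 < \<sigma>" "\<And>v. \<sigma> * (norm v)\<^sup>2 \<le> A v v"
    using assms(2) unfolding strongly_positive_def by blast
  moreover have "A u v = A v u" for u v using assms(1) by (simp add: symmetric_op_def)
  moreover have "bounded_bilinear (\<lambda>u v. blinfun_apply (blinfun_apply A u) v)"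
    by (intro bounded_bilinear.comp1[OF bounded_bilinear_blinfun_apply] blinfun.bounded_linear_right)
  ultimately have "coercive_form (\<lambda>u v. blinfun_apply (blinfun_apply A u) v) \<sigma>"
    unfolding coercive_form_def coercive_form_axioms_def by blast
  then show thesis by (rule that)
qed

lemma opE_apply [simp]: "opE j u v = j u \<bullet> j v"
  by (simp add: opE_def inner_commute)

text \<open>
  Below \<open>lam 2\<close> the spectrum is at most \<open>{lam 1}\<close>: the other eigenvalues and the remainder of the
  spectrum are at least \<open>lam 2\<close>.
\<close>

lemma not_in_spectrum:
  assumes "spectral_assumption A j N lam" and "\<mu> < lam 2" and "\<mu> \<noteq> lam 1"
  shows "\<mu> \<in> resolvent_set A j"
proof (rule ccontr)
  assume "\<mu> \<notin> resolvent_set A j"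
  then have \<mu>: "\<mu> \<in> spectrum A j" by (simp add: spectrum_def)
  have mono: "strict_mono_on {1..N} lam" and N: "2 \<le> N"
    using assms(1) by (auto simp: spectral_assumption_def)
  obtain \<Lambda> where "lam N < \<Lambda>" and \<Lambda>: "\<And>\<mu>. \<mu> \<in> spectrum A j - lam ` {1..N} \<Longrightarrow> \<Lambda> \<le> \<mu>"
    using assms(1) unfolding spectral_assumption_def by (elim conjE exE) (auto simp: Ball_def)
  have ge: "lam 2 \<le> lam i" if "2 \<le> i" "i \<le> N" for i
    using strict_mono_onD[OF mono, of 2 i] that by (cases "i = 2") auto
  have "\<mu> \<notin> lam ` {1..N}"
  proof
    assume "\<mu> \<in> lam ` {1..N}"
    then obtain i where i: "1 \<le> i" "i \<le> N" "\<mu> = lam i" by auto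
    then show False using ge[of i] assms(2,3) by (cases "i = 1") auto
  qed
  with \<mu> have "\<Lambda> \<le> \<mu>" using \<Lambda> by blast
  then show False using ge[of N] N \<open>lam N < \<Lambda>\<close> assms(2) by simp
qed

text \<open>
  With \<open>\<mu> = 1 / m\<close>, the equation \<open>T u - m u = x\<close> amounts to \<open>A u - \<mu> E u = - \<mu> A x\<close>, whose right-hand
  side belongs to \<open>V\<^sup>*\<close> but in general not to \<open>H\<^sup>*\<close>, where the resolvent acts. Applying \<open>T\<close> first
  repairs this: \<open>w = T u\<close> solves \<open>A w - \<mu> E w = - \<mu> E x\<close>, and \<open>u = \<mu> (w - x)\<close> is recovered from \<open>w\<close>.
\<close>

lemma resolvent_shift:
  fixes A :: "'v::real_normed_vector \<Rightarrow>\<^sub>L ('v \<Rightarrow>\<^sub>L real)" and j :: "'v \<Rightarrow>\<^sub>L 'h::real_inner"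
  assumes T: "\<And>u. A (T u) = opE j u" and inj: "inj (blinfun_apply A)"
    and m: "0 < m" "1 / m \<in> resolvent_set A j"
  shows "\<exists>u. T u - m *\<^sub>R u = x"
    and "\<exists>C. \<forall>u. norm u \<le> C * norm (T u - m *\<^sub>R u)"
proof -
  define \<mu> where "\<mu> = 1 / m"
  have \<mu>m: "\<mu> * m = 1" "m * \<mu> = 1" using m(1) by (auto simp: \<mu>_def)
  define R where "R f = (THE u. A u - \<mu> *\<^sub>R opE j u = f o\<^sub>L j)" for f
  have ex1: "\<exists>!u. A u - \<mu> *\<^sub>R opE j u = f o\<^sub>L j" for f
    using m(2) unfolding resolvent_set_def \<mu>_def[symmetric] by blast
  have R_bounded: "bounded_linear R"
    using m(2) unfolding resolvent_set_def R_def \<mu>_def[symmetric] by blast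
  have R: "A (R f) - \<mu> *\<^sub>R opE j (R f) = f o\<^sub>L j" for f
    unfolding R_def by (rule theI'[OF ex1])
  have R_eq: "u = R f" if "A u - \<mu> *\<^sub>R opE j u = f o\<^sub>L j" for u f
    using ex1[of f] R[of f] that by blast
  interpret A: bounded_linear "blinfun_apply A" by (rule blinfun.bounded_linear_right)
  have A_eqI: "x = y" if "A x = A y" for x y using inj that by (rule injD)
  have T_lin: "T (u - c *\<^sub>R v) = T u - c *\<^sub>R T v" for u v c
    by (intro A_eqI blinfun_eqI)
      (simp add: A.diff A.scaleR T blinfun.diff_left blinfun.scaleR_left blinfun.diff_right
        blinfun.scaleR_right inner_diff_left)
  define F where "F x = (- \<mu>) *\<^sub>R blinfun_inner_left (j x)" for x
  have F: "F x o\<^sub>L j = - (\<mu> *\<^sub>R opE j x)" for x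
    by (rule blinfun_eqI) (simp add: F_def blinfun.minus_left blinfun.scaleR_left inner_commute)
  show "\<exists>u. T u - m *\<^sub>R u = x"
  proof -
    define w where "w = R (F x)"
    have "A (w - \<mu> *\<^sub>R T w) = A (0 - \<mu> *\<^sub>R T x)"
      using R[of "F x"] unfolding F w_def[symmetric] by (simp only: A.diff A.scaleR T A.zero) simp
    then have "w - \<mu> *\<^sub>R T w = 0 - \<mu> *\<^sub>R T x" by (rule A_eqI)
    then have "w = \<mu> *\<^sub>R (T w - T x)" by (simp add: algebra_simps)
    moreover have "T (\<mu> *\<^sub>R (w - x)) = \<mu> *\<^sub>R (T w - T x)"
      using T_lin[of 0 "- \<mu>" "w - x"] T_lin[of w 1 x] T_lin[of 0 1 0] by simp
    ultimately have "T (\<mu> *\<^sub>R (w - x)) - m *\<^sub>R (\<mu> *\<^sub>R (w - x)) = x"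
      by (simp add: \<mu>m)
    then show ?thesis by blast
  qed
  obtain K where "0 < K" and K: "\<And>f. norm (R f) \<le> norm f * K"
    using bounded_linear.pos_bounded[OF R_bounded] by blast
  have F_norm: "norm (F x) \<le> \<mu> * (norm j * norm x)" for x
  proof -
    have "norm (blinfun_inner_left (j x)) \<le> norm (j x)"
      by (rule norm_blinfun_bound) (auto simp: mult.commute Cauchy_Schwarz_ineq2)
    also have "\<dots> \<le> norm j * norm x" by (rule norm_blinfun)
    finally show ?thesis using m(1) by (simp add: F_def \<mu>_def divide_right_mono)
  qed
  have "norm u \<le> \<mu> * (\<mu> * norm j * K + 1) * norm (T u - m *\<^sub>R u)" for u
  proof -
    define x where "x = T u - m *\<^sub>R u"
    have "T x = T (T u) - m *\<^sub>R T u" unfolding x_def by (rule T_lin)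
    then have "A (\<mu> *\<^sub>R T x) = A (\<mu> *\<^sub>R T (T u) - T u)" by (simp add: scaleR_diff_right \<mu>m)
    then have "A (T u) - \<mu> *\<^sub>R opE j (T u) = F x o\<^sub>L j"
      unfolding F by (simp only: A.diff A.scaleR T) (simp add: algebra_simps)
    then have "T u = R (F x)" by (rule R_eq)
    then have "norm (T u) \<le> norm (F x) * K" using K by simp
    also have "\<dots> \<le> \<mu> * (norm j * norm x) * K" using F_norm \<open>0 < K\<close> by (simp add: mult_right_mono)
    finally have Tu: "norm (T u) \<le> \<mu> * norm j * K * norm x" by (simp add: algebra_simps)
    have "u = \<mu> *\<^sub>R (T u - x)" by (simp add: x_def \<mu>m)
    then have "norm u = \<mu> * norm (T u - x)" using m(1) by (metis \<mu>_def abs_of_pos norm_scaleR zero_less_divide_1_iff)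
    also have "\<dots> \<le> \<mu> * (\<mu> * norm j * K * norm x + norm x)"
      using norm_triangle_ineq4[of "T u" x] Tu m(1) by (intro mult_left_mono) (auto simp: \<mu>_def)
    finally show ?thesis by (simp add: x_def algebra_simps)
  qed
  then show "\<exists>C. \<forall>u. norm u \<le> C * norm (T u - m *\<^sub>R u)" by blast
qed

theorem theorem4:
  fixes j :: "'v::banach \<Rightarrow>\<^sub>L 'h::{real_inner,complete_space}"
    and A :: "'v \<Rightarrow>\<^sub>L ('v \<Rightarrow>\<^sub>L real)"
    and N :: nat and lam :: "nat \<Rightarrow> real" and v :: 'v
  assumes "gelfand_triple j"
    and "symmetric_op A"
    and "strongly_positive A"
    and "spectral_assumption A j N lam"
    and "v \<noteq> 0"
    and "lam 1 \<le> rayleigh A j v"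
    and "rayleigh A j v < lam 2"
  shows "sin (angle_A A v (eigenspace A j (lam 1)))
           \<le> sqrt (lam 2 / lam 1 * ((rayleigh A j v - lam 1) / (lam 2 - rayleigh A j v))) \<and>
         lam 1 / (3 * rayleigh A j v) * residual A j v
           \<le> sin (angle_A A v (eigenspace A j (lam 1))) \<and>
         sin (angle_A A v (eigenspace A j (lam 1)))
           \<le> lam 2 / (lam 2 - rayleigh A j v) * residual A j v"
proof -
  obtain \<sigma> where "coercive_form (\<lambda>u v. blinfun_apply (blinfun_apply A u) v) \<sigma>"
    using assms(2,3) by (rule coercive_form_if_strongly_positive)
  then interpret coercive_form "\<lambda>u v. blinfun_apply (blinfun_apply A u) v" \<sigma> .
  have inj: "inj (blinfun_apply A)" by (rule injI) (metis eq_if_form_eq)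
  have lam1: "0 < lam 1" and lam12: "lam 1 < lam 2"
    using assms(4,6,7) by (auto simp: spectral_assumption_def)
  note resolvent = not_in_spectrum[OF assms(4)]
  have "\<exists>w. A w = opE j u" for u
  proof -
    have "0 \<in> resolvent_set A j" using resolvent[of 0] lam1 lam12 by simp
    then have "\<exists>w. A w - 0 *\<^sub>R opE j w = blinfun_inner_left (j u) o\<^sub>L j"
      unfolding resolvent_set_def by blast
    then show ?thesis by (simp add: opE_def)
  qed
  then have "\<exists>T. \<forall>u. A (T u) = opE j u" by (intro choice) blast
  then obtain T where T: "\<And>u. A (T u) = opE j u" by blast
  have T_form: "A (T u) w = j u \<bullet> j w" for u w by (simp add: T)
  have T_selfadjoint: "selfadjoint T"
    unfolding selfadjoint_def by (metis T_form inner_commute sym)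
  have T_nonneg: "0 \<le> A (T u) u" for u by (simp add: T_form)
  have T_bound: "A (T u) u \<le> ((norm j)\<^sup>2 / \<sigma>) * A u u" for u
  proof -
    have "A (T u) u = (norm (j u))\<^sup>2" by (simp add: T_form power2_norm_eq_inner)
    also have "\<dots> \<le> (norm j * norm u)\<^sup>2" by (intro power_mono norm_blinfun) simp
    also have "\<dots> = (norm j)\<^sup>2 / \<sigma> * (\<sigma> * (norm u)\<^sup>2)" using \<sigma>_pos by (simp add: power_mult_distrib)
    also have "\<dots> \<le> (norm j)\<^sup>2 / \<sigma> * A u u" using coercive[of u] \<sigma>_pos by (intro mult_left_mono) auto
    finally show ?thesis .
  qed
  have ba: "1 / lam 2 < 1 / lam 1" using lam1 lam12 by (simp add: frac_less2)
  have above: "0 < m" "1 / m \<in> resolvent_set A j" if "1 / lam 1 < m" for m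
  proof -
    show "0 < m" using that lam1 by (smt (verit) zero_less_divide_1_iff)
    then have "1 / m < lam 1" using that lam1 by (simp add: field_simps)
    then show "1 / m \<in> resolvent_set A j" using resolvent lam12 by simp
  qed
  have between: "0 < m" "1 / m \<in> resolvent_set A j" if "1 / lam 2 < m" "m < 1 / lam 1" for m
  proof -
    show "0 < m" using that lam1 lam12 by (smt (verit) zero_less_divide_1_iff)
    then have "1 / m < lam 2" "lam 1 < 1 / m" using that lam1 lam12 by (auto simp: field_simps)
    then show "1 / m \<in> resolvent_set A j" using resolvent by simp
  qed
  have bounded_below: "bounded_below (\<lambda>u. T u - m *\<^sub>R u)" if "0 < m" "1 / m \<in> resolvent_set A j" for m
  proof -
    from resolvent_shift(2)[OF T inj that]
    obtain C where "\<And>u. norm u \<le> C * norm (T u - m *\<^sub>R u)" by blast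
    then show ?thesis by (rule bounded_below_if_norm_bound)
  qed
  note spectral = T_selfadjoint T_bound T_nonneg
  obtain p q where v: "v = p + q" and p: "T p = (1 / lam 1) *\<^sub>R p"
    and q_orth: "\<And>e. T e = (1 / lam 1) *\<^sub>R e \<Longrightarrow> A q e = 0"
    and q: "A (T q) q \<le> 1 / lam 2 * A q q"
  proof (rule top_eigenspace_decomposition[OF spectral ba, where x = v])
    show "bounded_below (\<lambda>u. T u - m *\<^sub>R u)" if "1 / lam 1 < m" for m
      by (rule bounded_below[OF above[OF that]])
    show "\<exists>y. T y - m *\<^sub>R y = x" if "1 / lam 1 < m" for m x
      by (rule resolvent_shift(1)[OF T inj above[OF that]])
    show "bounded_below (\<lambda>u. T u - m *\<^sub>R u)" if "1 / lam 2 < m" "m < 1 / lam 1" for m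
      by (rule bounded_below[OF between[OF that]])
  qed blast
  define l where "l = rayleigh A j v"
  have l: "lam 1 \<le> l" "l < lam 2" using assms(6,7) by (auto simp: l_def)
  have vv: "0 < A v v" using form_pos[OF assms(5)] .
  have quotient: "A v v = l * A (T v) v"
  proof -
    have "j v \<bullet> j v \<noteq> 0" using l lam1 by (auto simp: l_def rayleigh_def)
    then show ?thesis by (simp add: T_form l_def rayleigh_def)
  qed
  have upper: "A (T u) u \<le> 1 / lam 1 * A u u" for u
    by (rule top_of_spectrum_bound[OF spectral bounded_below[OF above]])
  have qp: "A q p = 0" using q_orth p by blast
  note bounds = eigenvector_error_bounds[OF T_selfadjoint T_nonneg upper p q qp v lam1 l quotient]
  have eigenspace: "e \<in> eigenspace A j (lam 1) \<longleftrightarrow> T e = (1 / lam 1) *\<^sub>R e" for e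
  proof -
    have "e \<in> eigenspace A j (lam 1) \<longleftrightarrow> A e = A (lam 1 *\<^sub>R T e)"
      by (simp add: eigenspace_def blinfun.scaleR_right T)
    also have "\<dots> \<longleftrightarrow> e = lam 1 *\<^sub>R T e" using inj by (auto dest: injD)
    also have "\<dots> \<longleftrightarrow> T e = (1 / lam 1) *\<^sub>R e"
      using lam1 eq_vector_fraction_iff[of "T e" 1 "lam 1" e] by auto
    finally show ?thesis .
  qed
  have proj: "A_proj A (eigenspace A j (lam 1)) v = p"
    unfolding A_proj_def eigenspace
  proof (rule the_equality)
    show "T p = (1 / lam 1) *\<^sub>R p \<and> (\<forall>w\<in>eigenspace A j (lam 1). A (v - p) w = 0)"
      using p q_orth by (auto simp: v eigenspace simp del: One_nat_def)
    fix p' assume p': "T p' = (1 / lam 1) *\<^sub>R p' \<and> (\<forall>w\<in>eigenspace A j (lam 1). A (v - p') w = 0)"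
    define e where "e = p - p'"
    have e: "T e = (1 / lam 1) *\<^sub>R e"
      using p p' by (simp add: e_def selfadjoint_diff[OF T_selfadjoint] scaleR_diff_right)
    have "e = (v - p') - q" by (simp add: e_def v)
    then have "A e e = A (v - p') e - A q e" by (metis diff_left)
    also have "\<dots> = 0" using p' q_orth[OF e] e eigenspace[of e] by auto
    finally show "p' = p" using form_eq_0_iff[of e] by (simp add: e_def)
  qed
  have "A q q \<le> A v v" using form_nonneg[of p] sym[of p q] by (simp add: v form_simps qp)
  then have sine: "sin (angle_A A v (eigenspace A j (lam 1))) = sqrt (A q q) / sqrt (A v v)"
    unfolding angle_A_def proj norm_A_def using vv form_nonneg[of q]
    by (subst sin_arcsin) (auto simp: v intro: order_trans[OF _ divide_nonneg_nonneg])
  define \<rho> where "\<rho> = A (v - l *\<^sub>R T v) (v - l *\<^sub>R T v)"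
  have residual: "residual A j v = sqrt \<rho> / sqrt (A v v)"
  proof -
    have "A v - l *\<^sub>R opE j v = A (v - l *\<^sub>R T v)"
      by (simp add: blinfun.diff_right blinfun.scaleR_right T)
    then show ?thesis
      by (simp add: residual_def norm_A_inv_def norm_A_def \<rho>_def inv_f_f[OF inj] flip: l_def)
  qed
  have s: "0 < sqrt (A v v)" using vv by simp
  have "sqrt (A q q) \<le> sqrt (lam 2 / lam 1 * ((l - lam 1) / (lam 2 - l))) * sqrt (A v v)"
    using bounds(1) by (simp flip: real_sqrt_mult)
  then have first: "sqrt (A q q) / sqrt (A v v) \<le> sqrt (lam 2 / lam 1 * ((l - lam 1) / (lam 2 - l)))"
    using s by (simp add: pos_divide_le_eq)
  have "sqrt \<rho> \<le> 3 * l / lam 1 * sqrt (A q q)"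
    using real_sqrt_le_mono[OF bounds(2)] lam1 l unfolding \<rho>_def[symmetric]
    by (simp add: real_sqrt_mult)
  then have "lam 1 / (3 * l) * sqrt \<rho> \<le> sqrt (A q q)"
    using lam1 l by (simp add: field_simps)
  then have second: "lam 1 / (3 * l) * (sqrt \<rho> / sqrt (A v v)) \<le> sqrt (A q q) / sqrt (A v v)"
    using s divide_right_mono by fastforce
  have "sqrt (A q q) \<le> lam 2 / (lam 2 - l) * sqrt \<rho>"
    using real_sqrt_le_mono[OF bounds(3)] lam1 l unfolding \<rho>_def[symmetric]
    by (simp add: real_sqrt_mult)
  then have third: "sqrt (A q q) / sqrt (A v v) \<le> lam 2 / (lam 2 - l) * (sqrt \<rho> / sqrt (A v v))"
    using s divide_right_mono by fastforce
  show ?thesis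
    unfolding sine residual l_def[symmetric] using first second third by blast
qed

end
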